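(* For every integer $n\geq 1$ the following two identities hold: \[ \sum_{i,j\geq0} (-1)^j q^{i^2 + 3ij + \frac{3j(3j+1)}{2}} {n-i-3j\brack i}_q {n-i-2j-1\brack j}_{q^3} = \sum_{j\geq0} q^{j(3j+1)}(q^2;q^3)_j{n\brack 3j+1}_q, \] and \[ \sum_{i,j\geq0} (-1)^j q^{i^2 + 3ij + \frac{3j(3j+1)}{2}} {n-i-3j\brack i}_q {n-i-2j-1\brack j}_{q^3} - q\sum_{i,j\geq0} (-1)^j q^{i(i+1) + 3ij + \frac{9j(j+1)}{2}} {n-i-3j-1\brack i}_q {n-i-2j-2\brack j}_{q^3}= \sum_{j\geq0} q^{j(3j-1)}(q;q^3)_j{n\brack 3j}_q. \]
   Context: For $n\in\mathbb{Z}_{\geq0}$, $(a;q)_n := \prod_{i=0}^{n-1}(1-aq^i)$. The $q$-binomial coefficient is defined by ${A+B\brack B}_q = \frac{(q;q)_{A+B}}{(q;q)_A(q;q)_B}$ if $A,B\geq 0$ are integers, and ${A+B\brack B}_q=0$ otherwise; that is, ${N\brack B}_q$ is zero unless $0\le B\le N$. The symbol ${N\brack B}_{q^3}$ denotes the same expression with $q$ replaced by $q^3$. The indices $i,j$ run over non-negative integers, and all sums are finite. *)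

theory Defs
  imports Main "HOL-Library.Groups_Big_Fun"
begin

(* The base q is an arbitrary element of an arbitrary field. Where the quotient in qbinom matters,
   q is assumed not to be a root of unity (q ^ k \<noteq> 1 for all k \<ge> 1), so that no denominator
   vanishes. This covers an indeterminate q (in a field of rational functions or of formal Laurent
   series) as well as a complex number q with |q| < 1. *)

definition qpoch :: "'a::field \<Rightarrow> 'a \<Rightarrow> nat \<Rightarrow> 'a" where
  "qpoch a q n = (\<Prod>i<n. 1 - a * q ^ i)"

(* The arguments are integers because the upper entry N = A + B can be negative; then the value is 0. *)
definition qbinom :: "'a::field \<Rightarrow> int \<Rightarrow> int \<Rightarrow> 'a" where
  "qbinom q N B =
     (if 0 \<le> B \<and> B \<le> N
      then qpoch q q (nat N) / (qpoch q q (nat (N - B)) * qpoch q q (nat B))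
      else 0)"

lemma qpoch_nonzero:
  assumes "\<And>k::nat. k \<ge> 1 \<Longrightarrow> q ^ k \<noteq> (1::'a::field)"
  shows "qpoch q q n \<noteq> 0"
proof -
  have "1 - q * q ^ i \<noteq> 0" for i
    using assms[of "Suc i"] by simp
  then show ?thesis
    by (simp add: qpoch_def)
qed

(* Sums over all i, j \<ge> 0 are rendered by Sum_any, which is 0 on functions of infinite support.
   The next two lemmas show that q-binomial sums of the shapes needed have finite support:
   (a, b) = (n, n - 1) and (n - 1, n - 2), r = q^3, in the double sums; s = 1 and s = 0 in the
   single ones. *)

lemma finite_support_double:
  fixes c :: "nat \<Rightarrow> nat \<Rightarrow> 'a::field" and a b :: int
  shows "finite {p. (case p of (i, j) \<Rightarrow>
           c i j * qbinom q (a - int i - 3 * int j) (int i)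
                 * qbinom r (b - int i - 2 * int j) (int j)) \<noteq> 0}"
proof (rule finite_subset)
  show "{p. (case p of (i, j) \<Rightarrow>
           c i j * qbinom q (a - int i - 3 * int j) (int i)
                 * qbinom r (b - int i - 2 * int j) (int j)) \<noteq> 0} \<subseteq> {..nat a} \<times> {..nat b}"
    by (auto simp: qbinom_def split: if_splits)
qed simp

lemma finite_support_single:
  fixes c :: "nat \<Rightarrow> 'a::field"
  shows "finite {j. c j * qbinom q (int n) (3 * int j + s) \<noteq> 0}"
proof (rule finite_subset)
  show "{j. c j * qbinom q (int n) (3 * int j + s) \<noteq> 0} \<subseteq> {..nat (int n - s)}"
    by (auto simp: qbinom_def split: if_splits)
qed simp

end

theory Submission
  imports Defs "HOL-Computational_Algebra.Formal_Power_Series"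
begin

unbundle fps_syntax

text \<open>
  Put \<open>L = i + 3j\<close> and \<open>M = n - L\<close>. The \<open>q\<close>-binomial theorem turns the sum over \<open>j\<close> into the
  coefficient of \<open>x^L\<close> in \<open>(-x;q)_M / (-x^3;q^3)_M\<close>, that is, in the reciprocal of the product of
  the \<open>1 - x q^m + x^2 q^(2m)\<close> with \<open>m < M\<close>. Splitting off the factor \<open>m = 0\<close> yields a recurrence
  which exhibits the double sum as the continuant with diagonal entries \<open>1 + q^k\<close> \<open>(0 < k < n)\<close> and
  off-diagonal products \<open>q^(2k+1)\<close>. Expanding this continuant at its other end gives the recurrence
  \<open>h_(n+2) = (1 + q^(n+1)) h_(n+1) - q^(2n+1) h_n\<close>. A sum of \<open>[n,k] a_k\<close> over \<open>k\<close> satisfies it as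
  soon as \<open>a_2 = 0\<close> and \<open>a_(k+3) = q^(2k+2) (1 - q^(k+1)) a_k\<close>, so both identities follow by
  comparing initial values.
\<close>

section \<open>Absorption and the two Pascal rules for q-binomial coefficients\<close>

lemma qpoch_Suc: "qpoch a q (Suc n) = qpoch a q n * (1 - a * q ^ n)"
  by (simp add: qpoch_def)

lemma qbinom_of_nat:
  "qbinom q (int n) (int k) =
     (if k \<le> n then qpoch q q n / (qpoch q q (n - k) * qpoch q q k) else 0)"
  by (simp add: qbinom_def nat_diff_distrib flip: of_nat_diff)

text \<open>A locale makes the Pascal rules available in base \<open>q ^ 3\<close> as well, where
  the denominator series needs them.\<close>

locale not_root_of_unity =
  fixes q :: "'a::field"
  assumes power_neq_1: "k \<ge> 1 \<Longrightarrow> q ^ k \<noteq> 1"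
begin

lemma qpoch_neq_0 [simp]: "qpoch q q n \<noteq> 0"
  using qpoch_nonzero power_neq_1 by blast

lemma power_Suc_neq_1 [simp]: "q * q ^ k \<noteq> 1"
  using power_neq_1[of "Suc k"] by simp

lemma qbinom_0 [simp]: "qbinom q (int n) 0 = 1"
  using qbinom_of_nat[of q n 0] by (simp add: qpoch_def[of q q 0])

lemma qbinom_absorb:
  "(1 - q ^ Suc k) * qbinom q (int n) (int (Suc k)) = (1 - q ^ (n - k)) * qbinom q (int n) (int k)"
proof (cases "k < n")
  case True
  then obtain d where n: "n = k + Suc d"
    using less_imp_Suc_add by auto
  define x y where "x = 1 - q * q ^ d" and "y = 1 - q * q ^ k"
  have "x \<noteq> 0" "y \<noteq> 0"
    by (simp_all add: x_def y_def)
  moreover have "qbinom q (int n) (int k) = qpoch q q n / (qpoch q q d * x * qpoch q q k)"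
    and "qbinom q (int n) (int (Suc k)) = qpoch q q n / (qpoch q q d * (qpoch q q k * y))"
    unfolding qbinom_of_nat by (simp_all add: n qpoch_Suc[of q q d] qpoch_Suc[of q q k] x_def y_def)
  moreover have "1 - q ^ (n - k) = x" "1 - q ^ Suc k = y"
    by (simp_all add: n x_def y_def)
  ultimately show ?thesis
    by simp
next
  \<comment> \<open>For \<open>k\<close> at least \<open>n\<close> both sides vanish: the truncated
    \<open>n - k\<close> is 0, so the factor on the right is \<open>1 - 1\<close>.\<close>
  case False
  then show ?thesis
    by (simp add: qbinom_of_nat del: of_nat_Suc)
qed

lemma qbinom_Suc_Suc:
  "qbinom q (int (Suc n)) (int (Suc k)) =
     qbinom q (int n) (int k) + q ^ Suc k * qbinom q (int n) (int (Suc k))"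
proof -
  consider "k < n" | "k = n" | "k > n" by linarith
  then show ?thesis
  proof cases
    case 1
    then obtain d where n: "n = k + Suc d"
      using less_imp_Suc_add by auto
    \<comment> \<open>Over a common denominator the rule becomes
      \<open>1 - q ^ Suc n = y + (1 - y) * x\<close>.\<close>
    define x y where "x = 1 - q * q ^ d" and "y = 1 - q * q ^ k"
    have "x \<noteq> 0" "y \<noteq> 0"
      by (simp_all add: x_def y_def)
    moreover have "qbinom q (int n) (int k) = qpoch q q n / (qpoch q q d * x * qpoch q q k)"
      and "qbinom q (int n) (int (Suc k)) = qpoch q q n / (qpoch q q d * (qpoch q q k * y))"
      unfolding qbinom_of_nat by (simp_all add: n qpoch_Suc[of q q d] qpoch_Suc[of q q k] x_def y_def)
    moreover have "qbinom q (int (Suc n)) (int (Suc k)) =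
        qpoch q q n * (1 - q * q ^ n) / (qpoch q q d * x * (qpoch q q k * y))"
      unfolding qbinom_of_nat
      by (simp add: n qpoch_Suc[of q q d] qpoch_Suc[of q q k] qpoch_Suc[of q q "Suc (k + d)"] x_def y_def)
    moreover have "1 - q * q ^ n = y + (1 - y) * x" "q ^ Suc k = 1 - y"
      by (simp_all add: n x_def y_def algebra_simps power_add)
    moreover have "P * (y + (1 - y) * x) / (D * x * (K * y))
        = P / (D * x * K) + (1 - y) * (P / (D * (K * y)))"
      if "x \<noteq> 0" "y \<noteq> 0" "D \<noteq> 0" "K \<noteq> 0" for P D K x y :: 'a
      using that by (simp add: divide_simps) (simp add: algebra_simps)
    ultimately show ?thesis
      by (simp del: of_nat_Suc)
  qed (simp_all add: qbinom_of_nat qpoch_Suc qpoch_def[of q q 0] del: of_nat_Suc)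
qed

text \<open>The two Pascal rules differ exactly by \<open>qbinom_absorb\<close>.\<close>

lemma qbinom_Suc_Suc':
  "qbinom q (int (Suc n)) (int (Suc k)) =
     q ^ (n - k) * qbinom q (int n) (int k) + qbinom q (int n) (int (Suc k))"
  using qbinom_absorb[of k n] qbinom_Suc_Suc[of n k] by (simp add: algebra_simps)

lemma not_root_of_unity_power:
  assumes "m \<ge> 1" shows "not_root_of_unity (q ^ m)"
proof
  fix k :: nat
  assume "k \<ge> 1"
  with assms show "(q ^ m) ^ k \<noteq> 1"
    using power_neq_1[of "m * k"] by (simp add: power_mult)
qed

section \<open>The three-term recurrence and the single sums that satisfy it\<close>

definition rec_sol :: "(nat \<Rightarrow> 'a) \<Rightarrow> bool" where
  "rec_sol h \<longleftrightarrow> (\<forall>n. h (n + 2) = (1 + q ^ (n + 1)) * h (n + 1) - q ^ (2 * n + 1) * h n)"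

lemma rec_sol_unique:
  assumes "rec_sol f" "rec_sol g" "f 0 = g 0" "f 1 = g 1"
  shows "f n = g n"
proof -
  have "f n = g n \<and> f (n + 1) = g (n + 1)"
    by (induction n) (use assms in \<open>auto simp: rec_sol_def\<close>)
  then show ?thesis ..
qed

text \<open>By both Pascal rules, the recurrence operator in \<open>n\<close> turns
  \<open>qbinom q n k\<close> into \<open>y k - z k\<close>. The condition on \<open>a\<close> makes
  \<open>y (m + 3) * a (m + 3)\<close> equal to \<open>z m * a m\<close>, so terms three apart
  cancel; \<open>a 2 = 0\<close> removes the unmatched one at \<open>k = 2\<close>.\<close>

lemma rec_sol_qbinom_sum:
  assumes a2: "a 2 = 0"
    and a: "\<And>k. a (k + 3) = q ^ (2 * k + 2) * (1 - q ^ (k + 1)) * a k"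
  shows "rec_sol (\<lambda>n. \<Sum>k\<le>n. qbinom q (int n) (int k) * a k)"
  unfolding rec_sol_def
proof
  fix n
  let ?b = "\<lambda>n k. qbinom q (int n) (int k)"
  have ext: "(\<Sum>k\<le>m. ?b m k * a k) = (\<Sum>k\<le>n + 2. ?b m k * a k)" if "m \<le> n + 2" for m
    by (rule sum.mono_neutral_left) (use that in \<open>auto simp: qbinom_of_nat\<close>)
  \<comment> \<open>Without the guard, the truncated \<open>k - 2\<close> would give
    \<open>?b n 0\<close> for \<open>k < 2\<close>.\<close>
  define y where "y k = (if k < 2 then 0 else q ^ (n + 2 - k) * ?b n (k - 2))" for k
  define z where "z k = q ^ (n + k + 1) * (1 - q ^ (n - k)) * ?b n k" for k
  have X: "?b (n + 2) k - (1 + q ^ (n + 1)) * ?b (n + 1) k + q ^ (2 * n + 1) * ?b n k = y k - z k"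
    for k
  proof -
    have "q ^ (n + k + 1) * q ^ (n - k) * ?b n k = q ^ (2 * n + 1) * ?b n k"
      by (cases "k \<le> n") (auto simp: qbinom_of_nat mult_2 simp flip: power_add)
    then have z: "z k = q ^ (n + 1) * (q ^ k * ?b n k) - q ^ (2 * n + 1) * ?b n k"
      unfolding z_def right_diff_distrib left_diff_distrib by (simp add: power_add mult_ac)
    show ?thesis
    proof (cases k)
      case 0
      then show ?thesis
        using qbinom_0[of "n + 2"] qbinom_0[of "n + 1"] unfolding z by (simp add: y_def)
    next
      case (Suc l)
      \<comment> \<open>This is the weighted term of the second Pascal rule for
        \<open>?b (n + 2) k\<close>, expanded once more by the first rule.\<close>
      have "q ^ (Suc n - l) * ?b (Suc n) l = y k + q ^ (n + 1) * ?b n l"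
      proof (cases l)
        case 0
        with Suc show ?thesis
          using qbinom_0[of "n + 1"] by (simp add: y_def)
      next
        case (Suc m)
        have "q ^ (n - m) * q ^ Suc m = q ^ (n + 1)" if "m < n"
          using that by (simp flip: power_add power_Suc)
        then have "q ^ (n - m) * (q ^ Suc m * ?b n (Suc m)) = q ^ (n + 1) * ?b n (Suc m)"
          by (cases "m < n") (simp_all add: qbinom_of_nat mult.assoc[symmetric] del: of_nat_Suc power_Suc)
        moreover have "y k = q ^ (n - m) * ?b n m"
          using Suc \<open>k = Suc l\<close> by (simp add: y_def)
        ultimately show ?thesis
          using Suc qbinom_Suc_Suc[of n m] by (simp only: diff_Suc_Suc distrib_left)
      qed
      then have b2: "?b (n + 2) k = y k + q ^ (n + 1) * ?b n l + ?b (n + 1) k"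
        using qbinom_Suc_Suc'[of "Suc n" l] Suc by (simp only: add_2_eq_Suc' Suc_eq_plus1)
      have b1: "?b (n + 1) k = ?b n l + q ^ k * ?b n k"
        using qbinom_Suc_Suc[of n l] Suc by (simp only: Suc_eq_plus1)
      have "(u + s * c + b) - (1 + s) * b + t * b' = u - (s * (p * b') - t * b')"
        if "b = c + p * b'" for u s c b t b' p :: 'a
        unfolding that by (simp add: algebra_simps)
      from this[OF b1] show ?thesis
        unfolding b2 z .
    qed
  qed
  have "(\<Sum>k\<le>n + 2. y k * a k) = (\<Sum>m\<le>n. q ^ (n - m) * ?b n m * a (m + 2))"
    by (simp only: add_2_eq_Suc' sum.atMost_Suc_shift) (simp add: y_def)
  also have "\<dots> = (\<Sum>m<n. q ^ (n - Suc m) * ?b n (Suc m) * a (m + 3))"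
    by (simp add: a2[unfolded numeral_2_eq_2] sum.atMost_shift numeral_3_eq_3 numeral_2_eq_2 del: of_nat_Suc)
  also have "\<dots> = (\<Sum>m<n. z m * a m)"
  proof (rule sum.cong)
    fix m assume "m \<in> {..<n}"
    then have "n - Suc m + (2 * m + 2) = n + m + 1"
      by simp
    then have "q ^ (n - Suc m) * q ^ (2 * m + 2) = q ^ (n + m + 1)"
      by (metis power_add)
    moreover have "q ^ (n - Suc m) * ?b n (Suc m) * a (m + 3)
        = (q ^ (n - Suc m) * q ^ (2 * m + 2)) * ((1 - q ^ Suc m) * ?b n (Suc m)) * a m"
      unfolding a by (simp only: Suc_eq_plus1 mult_ac)
    ultimately have "q ^ (n - Suc m) * ?b n (Suc m) * a (m + 3)
        = q ^ (n + m + 1) * ((1 - q ^ Suc m) * ?b n (Suc m)) * a m"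
      by (simp only:)
    then show "q ^ (n - Suc m) * ?b n (Suc m) * a (m + 3) = z m * a m"
      unfolding qbinom_absorb z_def by (simp add: mult.assoc)
  qed simp
  \<comment> \<open>\<open>z k\<close> vanishes from \<open>k = n\<close> on, since the truncated
    \<open>n - k\<close> is 0 there.\<close>
  also have "\<dots> = (\<Sum>k\<le>n + 2. z k * a k)"
    by (rule sum.mono_neutral_left) (auto simp: z_def)
  finally have "(\<Sum>k\<le>n + 2. (y k - z k) * a k) = 0"
    by (simp add: algebra_simps sum_subtractf)
  moreover have "(\<Sum>k\<le>n + 2. ?b (n + 2) k * a k)
      - (1 + q ^ (n + 1)) * (\<Sum>k\<le>n + 2. ?b (n + 1) k * a k)
      + q ^ (2 * n + 1) * (\<Sum>k\<le>n + 2. ?b n k * a k) = (\<Sum>k\<le>n + 2. (y k - z k) * a k)"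
    unfolding X[symmetric] sum_distrib_left sum_subtractf[symmetric] sum.distrib[symmetric]
    by (rule sum.cong) (simp_all only: left_diff_distrib distrib_right mult.assoc)
  moreover have "(\<Sum>k\<le>n + 1. ?b (n + 1) k * a k) = (\<Sum>k\<le>n + 2. ?b (n + 1) k * a k)"
    and "(\<Sum>k\<le>n. ?b n k * a k) = (\<Sum>k\<le>n + 2. ?b n k * a k)"
    by (rule ext, simp)+
  moreover have "u = v - w" if "u - v + w = 0" for u v w :: 'a
    using that by (subst eq_iff_diff_eq_0) (simp add: algebra_simps)
  ultimately show "(\<Sum>k\<le>n + 2. ?b (n + 2) k * a k)
      = (1 + q ^ (n + 1)) * (\<Sum>k\<le>n + 1. ?b (n + 1) k * a k) - q ^ (2 * n + 1) * (\<Sum>k\<le>n. ?b n k * a k)"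
    by (simp only:)
qed

lemma Sum_any_eq_qbinom_sum:
  assumes "s < 3"
  shows "Sum_any (\<lambda>j. b j * qbinom q (int n) (3 * int j + int s)) =
    (\<Sum>k\<le>n. qbinom q (int n) (int k) * (if k mod 3 = s then b (k div 3) else 0))"
proof -
  have "Sum_any (\<lambda>j. b j * qbinom q (int n) (3 * int j + int s)) =
      (\<Sum>j | 3 * j + s \<le> n. b j * qbinom q (int n) (3 * int j + int s))"
  proof (rule Sum_any.expand_superset)
    show "finite {j. 3 * j + s \<le> n}"
      by (rule finite_subset[of _ "{..n}"]) auto
  qed (auto simp: qbinom_def split: if_splits)
  also have "\<dots> = (\<Sum>k | k \<le> n \<and> k mod 3 = s. qbinom q (int n) (int k) * b (k div 3))"
    by (rule sum.reindex_bij_witness[of _ "\<lambda>k. k div 3" "\<lambda>j. 3 * j + s"])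
      (use assms in \<open>auto simp: mult.commute\<close>)
  also have "\<dots> = (\<Sum>k\<le>n. qbinom q (int n) (int k) * (if k mod 3 = s then b (k div 3) else 0))"
    by (rule sum.mono_neutral_cong_left) auto
  finally show ?thesis .
qed

text \<open>With \<open>k = 3 * j + s\<close>, the three-step condition on \<open>a\<close> becomes
  a one-step condition on \<open>b\<close>; \<open>s < 2\<close> keeps index 2 outside the support,
  so that \<open>a 2 = 0\<close>.\<close>

lemma rec_sol_single_sum:
  assumes "s < 2"
    and b: "\<And>j. b (Suc j) = q ^ (6 * j + 2 * s + 2) * (1 - q ^ (3 * j + s + 1)) * b j"
  shows "rec_sol (\<lambda>n. Sum_any (\<lambda>j. b j * qbinom q (int n) (3 * int j + int s)))"
proof -
  define a where "a k = (if k mod 3 = s then b (k div 3) else 0)" for k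
  have "a (k + 3) = q ^ (2 * k + 2) * (1 - q ^ (k + 1)) * a k" for k
  proof (cases "k mod 3 = s")
    case True
    define j where "j = k div 3"
    then have k: "k = 3 * j + s" and k3: "k + 3 = 3 * Suc j + s"
      using True by auto
    have "a k = b j" "a (k + 3) = b (Suc j)"
      unfolding k3 unfolding k using assms(1)
      by (simp_all add: a_def mod_mult_self4 del: mult_Suc_right)
    then show ?thesis
      by (simp add: b k algebra_simps)
  qed (simp add: a_def)
  moreover have "a 2 = 0"
    using assms(1) by (simp add: a_def)
  ultimately show ?thesis
    using rec_sol_qbinom_sum[of a] Sum_any_eq_qbinom_sum[of s b] assms(1) by (simp add: a_def)
qed

section \<open>Generating functions in x\<close>

text \<open>By the q-binomial theorem \<open>num_fps M\<close> is (-x;q)_M and, for M > 0,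
  \<open>den_fps M\<close> is 1/(-x^3;q^3)_M.\<close>

definition num_fps :: "nat \<Rightarrow> 'a fps" where
  "num_fps M = Abs_fps (\<lambda>k. q ^ (k choose 2) * qbinom q (int M) (int k))"

definition den_fps :: "nat \<Rightarrow> 'a fps" where
  "den_fps M = Abs_fps (\<lambda>k. if 3 dvd k
     then (-1) ^ (k div 3) * qbinom (q ^ 3) (int M + int (k div 3) - 1) (int (k div 3)) else 0)"

text \<open>
  For \<open>M = 0\<close> the constant term of \<open>den_fps\<close> is \<open>qbinom _ (-1) 0 = 0\<close>, not \<open>1\<close>; this is why the
  case \<open>M = 0\<close> needs a correction term below.
\<close>

definition quot_fps :: "nat \<Rightarrow> 'a fps" where
  "quot_fps M = num_fps M * den_fps M"

lemma fps_compose_scale_nth: "(f oo (fps_const c * fps_X)) $ k = c ^ k * f $ k" for f :: "'a fps"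
  by (simp add: fps_compose_linear)

text \<open>Splitting the first factor off (-x;q)_(M+1) leaves (-qx;q)_M; on coefficients this is
  \<open>qbinom_Suc_Suc\<close>.\<close>

lemma num_fps_Suc: "num_fps (Suc M) = (1 + fps_X) * (num_fps M oo (fps_const q * fps_X))"
proof (rule fps_ext)
  fix k
  show "num_fps (Suc M) $ k = ((1 + fps_X) * (num_fps M oo (fps_const q * fps_X))) $ k"
  proof (cases k)
    case 0
    then show ?thesis
      using qbinom_0[of "Suc M"] by (simp add: num_fps_def fps_compose_scale_nth distrib_right)
  next
    case (Suc m)
    have "Suc m choose 2 = m + (m choose 2)"
      by (simp add: numeral_2_eq_2)
    then show ?thesis
      using qbinom_Suc_Suc[of M m] Suc
      by (simp add: num_fps_def fps_compose_scale_nth distrib_right)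
        (simp add: algebra_simps power_add)
  qed
qed

text \<open>Multiplication by 1 + x^3 cancels the first factor of the reciprocal product; on
  coefficients this is the first Pascal rule in base \<open>q ^ 3\<close>.\<close>

lemma den_fps_Suc:
  "(1 + fps_X ^ 3) * den_fps (Suc M) =
     (den_fps M oo (fps_const q * fps_X)) + (if M = 0 then 1 else 0)"
proof (rule fps_ext)
  fix k
  interpret cube: not_root_of_unity "q ^ 3"
    by (rule not_root_of_unity_power) simp
  have e0: "qbinom (q ^ 3) (int M - 1) 0 = (if M = 0 then 0 else 1)"
    using cube.qbinom_0[of "M - 1"] by (cases M) (auto simp: qbinom_def)
  show "((1 + fps_X ^ 3) * den_fps (Suc M)) $ k =
     ((den_fps M oo (fps_const q * fps_X)) + (if M = 0 then 1 else 0)) $ k"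
  proof (cases "3 dvd k")
    case False
    then have "\<not> 3 dvd k - 3" if "3 \<le> k"
      using that by presburger
    moreover have "k > 0"
      using False by (cases k) auto
    ultimately show ?thesis
      using False by (simp add: den_fps_def fps_compose_scale_nth distrib_right fps_X_power_mult_nth)
  next
    case True
    then obtain j where k: "k = 3 * j" ..
    show ?thesis
    proof (cases j)
      case 0
      then show ?thesis
        using k e0 cube.qbinom_0[of M]
        by (simp add: den_fps_def fps_compose_scale_nth distrib_right fps_X_power_mult_nth)
    next
      case (Suc m)
      then have "k - 3 = 3 * m" "k \<ge> 3" "k \<noteq> 0" "k = 3 * Suc m"
        using k by auto
      moreover have "(q ^ 3) ^ Suc m = q ^ (3 * Suc m)"
        by (rule power_mult[symmetric])
      ultimately show ?thesis
        using cube.qbinom_Suc_Suc[of "M + m" m]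
        by (simp add: den_fps_def fps_compose_scale_nth distrib_right fps_X_power_mult_nth
            del: power_Suc mult_Suc_right) (simp add: algebra_simps)
    qed
  qed
qed

text \<open>Since 1 + x^3 = (1 + x)(1 - x + x^2), the factor 1 + x of the numerator cancels and a
  quadratic remains.\<close>

lemma quot_fps_Suc:
  "(1 - fps_X + fps_X ^ 2) * quot_fps (Suc M) =
     (quot_fps M oo (fps_const q * fps_X)) + (if M = 0 then 1 else 0)"
proof -
  let ?c = "\<lambda>f. f oo (fps_const q * fps_X)"
  \<comment> \<open>The correction term of \<open>den_fps_Suc\<close> is multiplied by the rescaled
    \<open>num_fps 0\<close>, so it stays 1.\<close>
  have num_0: "num_fps 0 = 1"
  proof (rule fps_ext)
    fix k
    show "num_fps 0 $ k = 1 $ k"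
      using qbinom_0[of 0] qbinom_of_nat[of q 0 k]
      by (cases k) (auto simp: num_fps_def numeral_2_eq_2)
  qed
  have "(1 + fps_X) * ((1 - fps_X + fps_X ^ 2) * quot_fps (Suc M))
      = num_fps (Suc M) * ((1 + fps_X ^ 3) * den_fps (Suc M))"
    unfolding quot_fps_def by (simp add: algebra_simps power2_eq_square power3_eq_cube)
  also have "\<dots> = (1 + fps_X) * (?c (num_fps M) * (?c (den_fps M) + (if M = 0 then 1 else 0)))"
    unfolding num_fps_Suc den_fps_Suc by (simp add: mult.assoc)
  also have "\<dots> = (1 + fps_X) * (?c (quot_fps M) + (if M = 0 then 1 else 0))"
    by (simp add: quot_fps_def fps_compose_mult_distrib distrib_left num_0)
  finally have eq: "(1 + fps_X) * ((1 - fps_X + fps_X ^ 2) * quot_fps (Suc M)) = \<dots>" .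
  have "(1 + fps_X :: 'a fps) $ 0 \<noteq> 0"
    by simp
  then have "(1 + fps_X :: 'a fps) \<noteq> 0"
    by (metis fps_zero_nth)
  with eq show ?thesis
    by (metis mult_left_cancel)
qed

section \<open>The coefficient sums and their recurrences at both ends\<close>

text \<open>For n > 0 this is the continuant with diagonal entries \<open>1 + q ^ k\<close> for r <
  k < n + r and off-diagonal products \<open>q ^ (2 * k + 1)\<close>. Removing its first entry
  raises \<open>r\<close>, hence the parameter.\<close>

definition dsum :: "nat \<Rightarrow> nat \<Rightarrow> 'a" where
  "dsum r n = (\<Sum>L\<le>n. q ^ ((Suc L choose 2) + r * L) * quot_fps (n - L) $ L)"

text \<open>Hence the term \<open>L = n\<close> of \<open>dsum\<close> vanishes, and ranges can be
  cut or extended there.\<close>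

lemma quot_fps_0: "quot_fps 0 = 0"
proof -
  have "den_fps 0 = 0"
    by (rule fps_ext) (auto simp: den_fps_def qbinom_def)
  then show ?thesis by (simp add: quot_fps_def)
qed

lemma dsum_0: "dsum r 0 = 0"
  by (simp add: dsum_def quot_fps_0)

text \<open>The hypothesis excludes the one coefficient, at \<open>L = M = 0\<close>, that the
  correction term touches.\<close>

lemma quot_fps_Suc_nth:
  assumes "L + M > 0"
  shows "quot_fps (Suc M) $ L = q ^ L * quot_fps M $ L
    + (if L = 0 then 0 else quot_fps (Suc M) $ (L - 1))
    - (if L < 2 then 0 else quot_fps (Suc M) $ (L - 2))"
proof -
  have "((1 - fps_X + fps_X ^ 2) * quot_fps (Suc M)) $ L = q ^ L * quot_fps M $ L"
    using assms unfolding quot_fps_Suc by (auto simp: fps_compose_scale_nth)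
  moreover have "((1 - fps_X + fps_X ^ 2) * quot_fps (Suc M)) $ L = quot_fps (Suc M) $ L
    - (if L = 0 then 0 else quot_fps (Suc M) $ (L - 1))
    + (if L < 2 then 0 else quot_fps (Suc M) $ (L - 2))"
    by (simp add: distrib_right left_diff_distrib fps_X_power_mult_nth)
  ultimately show ?thesis
    by (simp only: algebra_simps)
qed

text \<open>The value 1 comes from the correction term of \<open>quot_fps_Suc\<close>.\<close>

lemma dsum_1: "dsum r 1 = 1"
proof -
  have "quot_fps 1 $ 0 = 1"
    using arg_cong[OF quot_fps_Suc[of 0], of "\<lambda>f. f $ 0"] by (simp add: quot_fps_0)
  then show ?thesis
    by (simp add: dsum_def quot_fps_0 numeral_2_eq_2)
qed

text \<open>Each part of \<open>quot_fps_Suc_nth\<close> sums to a \<open>dsum\<close> again: the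
  factor \<open>q ^ L\<close> raises \<open>r\<close> by 1, and shifting \<open>L\<close> by 1 or 2
  raises \<open>r\<close> by as much and leaves a constant power of \<open>q\<close>.\<close>

lemma dsum_rec_front:
  "dsum r (n + 2) = (1 + q ^ (r + 1)) * dsum (r + 1) (n + 1) - q ^ (2 * r + 3) * dsum (r + 2) n"
proof -
  define w where "w r L = q ^ ((Suc L choose 2) + r * L)" for r L
  define u where "u L = (if L = 0 then 0 else quot_fps (n + 2 - L) $ (L - 1))" for L
  define v where "v L = (if L < 2 then 0 else quot_fps (n + 2 - L) $ (L - 2))" for L
  have ch: "Suc m choose 2 = m + (m choose 2)" for m
    by (simp add: numeral_2_eq_2)
  have w1: "w r L * q ^ L = w (r + 1) L" for L
    by (simp add: w_def algebra_simps flip: power_add)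
  have w2: "w r (Suc L) = q ^ (r + 1) * w (r + 1) L" for L
    by (simp add: w_def ch algebra_simps flip: power_add)
  have w3: "w r (Suc (Suc L)) = q ^ (2 * r + 3) * w (r + 2) L" for L
    by (simp add: w_def ch algebra_simps eval_nat_numeral flip: power_add power_Suc)
  \<comment> \<open>The term \<open>L = n + 2\<close> is dropped so that \<open>n + 2 - L\<close> is
    a successor.\<close>
  have "dsum r (n + 2) = (\<Sum>L\<le>n + 1. w r L * quot_fps (n + 2 - L) $ L)"
    by (simp add: dsum_def w_def quot_fps_0)
  also have "\<dots> = (\<Sum>L\<le>n + 1. w (r + 1) L * quot_fps (n + 1 - L) $ L + w r L * u L - w r L * v L)"
  proof (rule sum.cong)
    fix L assume "L \<in> {..n + 1}"
    then have eq: "n + 2 - L = Suc (n + 1 - L)" and "L + (n + 1 - L) > 0"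
      by auto
    then have "quot_fps (n + 2 - L) $ L = q ^ L * quot_fps (n + 1 - L) $ L + u L - v L"
      unfolding u_def v_def eq by (rule_tac quot_fps_Suc_nth)
    then show "w r L * quot_fps (n + 2 - L) $ L =
        w (r + 1) L * quot_fps (n + 1 - L) $ L + w r L * u L - w r L * v L"
      by (simp only: w1[symmetric] distrib_left right_diff_distrib mult.assoc)
  qed simp
  also have "\<dots> = dsum (r + 1) (n + 1) + (\<Sum>L\<le>n + 1. w r L * u L) - (\<Sum>L\<le>n + 1. w r L * v L)"
    by (simp add: sum.distrib sum_subtractf dsum_def w_def)
  also have "(\<Sum>L\<le>n + 1. w r L * u L) = q ^ (r + 1) * dsum (r + 1) (n + 1)"
  proof -
    have "(\<Sum>L\<le>n + 1. w r L * u L) = (\<Sum>L\<le>n. w r (Suc L) * quot_fps (n + 1 - L) $ L)"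
      by (simp only: Suc_eq_plus1[symmetric] sum.atMost_Suc_shift) (simp add: u_def)
    also have "\<dots> = q ^ (r + 1) * (\<Sum>L\<le>n. w (r + 1) L * quot_fps (n + 1 - L) $ L)"
      by (simp only: w2 sum_distrib_left mult.assoc)
    also have "(\<Sum>L\<le>n. w (r + 1) L * quot_fps (n + 1 - L) $ L) = dsum (r + 1) (n + 1)"
      by (simp add: dsum_def w_def quot_fps_0)
    finally show ?thesis .
  qed
  also have "(\<Sum>L\<le>n + 1. w r L * v L) = q ^ (2 * r + 3) * dsum (r + 2) n"
  proof -
    have "(\<Sum>L\<le>n + 1. w r L * v L) = (\<Sum>L\<le>n + 2. w r L * v L)"
      by (simp add: v_def quot_fps_0)
    also have "\<dots> = (\<Sum>L\<le>n. w r (Suc (Suc L)) * quot_fps (n - L) $ L)"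
      by (simp only: add_2_eq_Suc' sum.atMost_Suc_shift) (simp add: v_def)
    also have "\<dots> = q ^ (2 * r + 3) * dsum (r + 2) n"
      by (simp only: w3 sum_distrib_left mult.assoc) (simp only: dsum_def w_def sum_distrib_left)
    finally show ?thesis .
  qed
  finally show ?thesis
    by (simp add: algebra_simps)
qed

text \<open>Expansions at the two ends commute: expand at the front, apply the induction hypothesis
  to both shorter sums, and reassemble.\<close>

lemma dsum_rec_back:
  "dsum r (n + 2) = (1 + q ^ (n + r + 1)) * dsum r (n + 1) - q ^ (2 * (n + r) + 1) * dsum r n"
proof (induction n arbitrary: r rule: less_induct)
  case (less n)
  \<comment> \<open>The inductive step also expands \<open>dsum r n\<close> at the front, which
    takes \<open>n >= 2\<close>.\<close>
  consider "n = 0" | "n = 1" | m where "n = m + 2"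
    by (metis One_nat_def add_2_eq_Suc' not0_implies_Suc)
  then show ?case
  proof cases
    case 1
    then show ?thesis
      using dsum_rec_front[of r 0] by (simp add: dsum_0 dsum_1[simplified])
  next
    case 2
    then show ?thesis
      using dsum_rec_front[of r 1] dsum_rec_front[of r 0] dsum_rec_front[of "r + 1" 0]
      by (simp add: dsum_0 dsum_1[simplified] numeral_2_eq_2 numeral_3_eq_3 algebra_simps)
  next
    case 3
    \<comment> \<open>Shortening at the front keeps \<open>n + r\<close> fixed, so the recurrences
      at the back share their coefficients.\<close>
    have idx: "m + 1 + 2 = n + 1" "m + 1 + 1 = m + 2" "m + 1 + (r + 1) = n + r" "m + (r + 2) = n + r"
      using 3 by simp_all
    have swap: "p * (b * u - c * u') - s * (b * v - c * v') = b * (p * u - s * v) - c * (p * u' - s * v')"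
      for p b c s u u' v v' :: 'a
      by (simp add: algebra_simps)
    have "dsum r (n + 2) = (1 + q ^ (r + 1)) * dsum (r + 1) (m + 1 + 2)
        - q ^ (2 * r + 3) * dsum (r + 2) (m + 2)"
      unfolding idx(1) 3[symmetric] by (rule dsum_rec_front)
    also have "dsum (r + 1) (m + 1 + 2) = (1 + q ^ (n + r + 1)) * dsum (r + 1) (m + 2)
        - q ^ (2 * (n + r) + 1) * dsum (r + 1) (m + 1)"
      using less.IH[of "m + 1" "r + 1", unfolded idx(2-)] 3 by simp
    also have "dsum (r + 2) (m + 2) = (1 + q ^ (n + r + 1)) * dsum (r + 2) (m + 1)
        - q ^ (2 * (n + r) + 1) * dsum (r + 2) m"
      using less.IH[of "m" "r + 2", unfolded idx(2-)] 3 by simp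
    also have "(1 + q ^ (r + 1)) *
          ((1 + q ^ (n + r + 1)) * dsum (r + 1) (m + 2) - q ^ (2 * (n + r) + 1) * dsum (r + 1) (m + 1))
        - q ^ (2 * r + 3) *
          ((1 + q ^ (n + r + 1)) * dsum (r + 2) (m + 1) - q ^ (2 * (n + r) + 1) * dsum (r + 2) m) =
        (1 + q ^ (n + r + 1)) *
          ((1 + q ^ (r + 1)) * dsum (r + 1) (m + 2) - q ^ (2 * r + 3) * dsum (r + 2) (m + 1))
        - q ^ (2 * (n + r) + 1) *
          ((1 + q ^ (r + 1)) * dsum (r + 1) (m + 1) - q ^ (2 * r + 3) * dsum (r + 2) m)"
      by (rule swap)
    finally show ?thesis
      using dsum_rec_front[of r "m + 1", unfolded idx] dsum_rec_front[of r m, folded 3]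
      by (simp only:)
  qed
qed

section \<open>The double sums as coefficient sums\<close>

text \<open>With \<open>L = i + 3 * j\<close>, the upper entries are \<open>n - L\<close> and
  \<open>n - L + j - 1\<close>, so for fixed \<open>L\<close> the sum is a convolution coefficient.
  Besides \<open>r * L\<close> the exponent is L(L+1)/2 + i(i-1)/2, whose second part belongs to
  \<open>num_fps\<close>. The free \<open>c\<close> covers the exponents of both double
  sums.\<close>

lemma double_sum_eq_dsum:
  assumes c: "\<And>i j. c i j = i ^ 2 + 3 * i * j + (3 * j * (3 * j + 1)) div 2 + r * (i + 3 * j)"
  shows "Sum_any (\<lambda>(i::nat, j::nat). (-1) ^ j * q ^ c i j
          * qbinom q (int n - int i - 3 * int j) (int i)
          * qbinom (q ^ 3) (int n - int i - 2 * int j - 1) (int j)) = dsum r n"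
    (is "Sum_any ?f = _")
proof -
  let ?g = "\<lambda>L k. q ^ ((Suc L choose 2) + r * L) * (num_fps (n - L) $ k * den_fps (n - L) $ (L - k))"
  have exponent: "c i j = (Suc (i + 3 * j) choose 2) + r * (i + 3 * j) + (i choose 2)" for i j
  proof -
    have even: "even (m * (m + 1))" for m :: nat
      by simp
    have "2 * (Suc m choose 2) = m * (m + 1)" for m
      by (simp add: choose_two)
    moreover have "2 * (i choose 2) + i = i * i"
      by (cases i) (simp_all add: choose_two)
    moreover have "2 * ((3 * j * (3 * j + 1)) div 2) = 3 * j * (3 * j + 1)"
      using even[of "3 * j"] by (rule dvd_mult_div_cancel)
    ultimately have "2 * (i ^ 2 + 3 * i * j + (3 * j * (3 * j + 1)) div 2)
        = 2 * ((Suc (i + 3 * j) choose 2) + (i choose 2))"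
      by (simp only: distrib_left) (simp add: power2_eq_square algebra_simps)
    then have "i ^ 2 + 3 * i * j + (3 * j * (3 * j + 1)) div 2
        = (Suc (i + 3 * j) choose 2) + (i choose 2)"
      by (simp only: mult_cancel1) simp
    then show ?thesis
      unfolding c by simp
  qed
  have "Sum_any ?f = sum ?f {(i, j). i + 3 * j \<le> n}"
  proof (rule Sum_any.expand_superset)
    show "finite {(i, j). i + 3 * j \<le> n}"
      by (rule finite_subset[of _ "{..n} \<times> {..n}"]) auto
  qed (auto simp: qbinom_def split: if_splits)
  also have "\<dots> = (\<Sum>(L, k) \<in> {(L, k). L \<le> n \<and> k \<le> L \<and> 3 dvd L - k}. ?g L k)"
  proof (rule sum.reindex_bij_witness[of _ "\<lambda>(L, k). (k, (L - k) div 3)" "\<lambda>(i, j). (i + 3 * j, i)"])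
    fix p assume "p \<in> {(i, j). i + 3 * j \<le> n}"
    then obtain i j where p: "p = (i, j)" and le: "i + 3 * j \<le> n" by auto
    then have arg: "int n - int i - 3 * int j = int (n - (i + 3 * j))"
      "int n - int i - 2 * int j - 1 = int (n - (i + 3 * j)) + int j - 1"
      by auto
    show "(case case p of (i, j) \<Rightarrow> (i + 3 * j, i) of (L, k) \<Rightarrow> ?g L k) = ?f p"
      unfolding p prod.case arg exponent
      by (simp add: num_fps_def den_fps_def power_add mult_ac)
  qed auto
  \<comment> \<open>Pairs with 3 not dividing \<open>L - k\<close> can be added, as
    \<open>den_fps\<close> has coefficient 0 there.\<close>
  also have "\<dots> = (\<Sum>(L, k) \<in> (SIGMA L:{..n}. {0..L}). ?g L k)"
  proof (rule sum.mono_neutral_left)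
    show "finite (SIGMA L:{..n}. {0..L})"
      by simp
    show "{(L, k). L \<le> n \<and> k \<le> L \<and> 3 dvd L - k} \<subseteq> (SIGMA L:{..n}. {0..L})"
      by auto
    show "\<forall>p \<in> (SIGMA L:{..n}. {0..L}) - {(L, k). L \<le> n \<and> k \<le> L \<and> 3 dvd L - k}.
        (case p of (L, k) \<Rightarrow> ?g L k) = 0"
      by (auto simp: den_fps_def split: if_splits)
  qed
  also have "\<dots> = dsum r n"
    by (simp add: dsum_def quot_fps_def fps_mult_nth sum_distrib_left flip: sum.Sigma)
  finally show ?thesis .
qed

section \<open>Comparison of the two sides by recurrence and initial values\<close>

lemma rec_sol_dsum: "rec_sol (dsum 0)"
  using dsum_rec_back[of 0] by (simp add: rec_sol_def)

text \<open>
  The value at \<open>0\<close> extends the second difference backwards: there the recurrence asks for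
  \<open>q * dsum 1 (-1) = -1\<close>.
\<close>
lemma rec_sol_dsum_diff:
  "rec_sol (\<lambda>n. if n = 0 then 1 else dsum 0 n - q * dsum 1 (n - 1))"
  unfolding rec_sol_def
proof
  fix n
  show "(if n + 2 = 0 then 1 else dsum 0 (n + 2) - q * dsum 1 (n + 2 - 1)) =
     (1 + q ^ (n + 1)) * (if n + 1 = 0 then 1 else dsum 0 (n + 1) - q * dsum 1 (n + 1 - 1))
     - q ^ (2 * n + 1) * (if n = 0 then 1 else dsum 0 n - q * dsum 1 (n - 1))"
  proof (cases n)
    case 0
    then show ?thesis
      using dsum_rec_back[of 0 0] by (simp add: dsum_0 dsum_1[simplified])
  next
    \<comment> \<open>Since \<open>m + 1 = n\<close>, \<open>dsum 1\<close> at \<open>m\<close> has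
      the same recurrence coefficients as \<open>dsum 0\<close> at \<open>n\<close>.\<close>
    case (Suc m)
    then show ?thesis
      using dsum_rec_back[of 0 n] arg_cong[OF dsum_rec_back[of 1 m], of "(*) q"]
      by (simp add: algebra_simps)
  qed
qed

lemma rec_sol_first_rhs:
  "rec_sol (\<lambda>n. Sum_any (\<lambda>j::nat.
     q ^ (j * (3 * j + 1)) * qpoch (q ^ 2) (q ^ 3) j * qbinom q (int n) (3 * int j + 1)))"
proof -
  have "rec_sol (\<lambda>n. Sum_any (\<lambda>j::nat.
     q ^ (j * (3 * j + 1)) * qpoch (q ^ 2) (q ^ 3) j * qbinom q (int n) (3 * int j + int 1)))"
  proof (rule rec_sol_single_sum)
    fix j :: nat
    have "Suc j * (3 * Suc j + 1) = 6 * j + 2 * 1 + 2 + j * (3 * j + 1)"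
      by (simp add: algebra_simps)
    moreover have "q ^ 2 * (q ^ 3) ^ j = q ^ (3 * j + 1 + 1)"
      by (simp add: power_mult power_add power2_eq_square)
    ultimately show "q ^ (Suc j * (3 * Suc j + 1)) * qpoch (q ^ 2) (q ^ 3) (Suc j) =
        q ^ (6 * j + 2 * 1 + 2) * (1 - q ^ (3 * j + 1 + 1)) *
        (q ^ (j * (3 * j + 1)) * qpoch (q ^ 2) (q ^ 3) j)"
      by (simp only: qpoch_Suc power_add mult_ac)
  qed simp
  then show ?thesis by simp
qed

lemma rec_sol_second_rhs:
  "rec_sol (\<lambda>n. Sum_any (\<lambda>j::nat.
     q ^ (j * (3 * j - 1)) * qpoch q (q ^ 3) j * qbinom q (int n) (3 * int j)))"
proof -
  have "rec_sol (\<lambda>n. Sum_any (\<lambda>j::nat.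
     q ^ (j * (3 * j - 1)) * qpoch q (q ^ 3) j * qbinom q (int n) (3 * int j + int 0)))"
  proof (rule rec_sol_single_sum)
    fix j :: nat
    \<comment> \<open>The case \<open>j = 0\<close> is separate because \<open>3 * j - 1\<close> is
      truncated there.\<close>
    have "Suc j * (3 * Suc j - 1) = 6 * j + 2 * 0 + 2 + j * (3 * j - 1)"
      by (cases j) (simp_all add: algebra_simps)
    moreover have "q * (q ^ 3) ^ j = q ^ (3 * j + 0 + 1)"
      by (simp add: power_mult)
    ultimately show "q ^ (Suc j * (3 * Suc j - 1)) * qpoch q (q ^ 3) (Suc j) =
        q ^ (6 * j + 2 * 0 + 2) * (1 - q ^ (3 * j + 0 + 1)) *
        (q ^ (j * (3 * j - 1)) * qpoch q (q ^ 3) j)"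
      by (simp only: qpoch_Suc power_add mult_ac)
  qed simp
  then show ?thesis by simp
qed

text \<open>Both sides start with 0, 1.\<close>

lemma first_rhs_eq_dsum:
  "Sum_any (\<lambda>j::nat.
     q ^ (j * (3 * j + 1)) * qpoch (q ^ 2) (q ^ 3) j * qbinom q (int n) (3 * int j + 1)) = dsum 0 n"
proof (rule rec_sol_unique[OF rec_sol_first_rhs rec_sol_dsum])
  let ?b = "\<lambda>j::nat. q ^ (j * (3 * j + 1)) * qpoch (q ^ 2) (q ^ 3) j"
  have "?b 0 = 1"
    by (simp add: qpoch_def)
  then show "Sum_any (\<lambda>j. ?b j * qbinom q (int 0) (3 * int j + 1)) = dsum 0 0"
    and "Sum_any (\<lambda>j. ?b j * qbinom q (int 1) (3 * int j + 1)) = dsum 0 1"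
    using Sum_any_eq_qbinom_sum[of 1 ?b 0] Sum_any_eq_qbinom_sum[of 1 ?b 1] qbinom_of_nat[of q 1 1]
    by (simp_all add: dsum_0 dsum_1[simplified] qpoch_def[of q q 0])
qed

text \<open>Both solutions start with 1, 1. At \<open>n = 0\<close> the right-hand side as written
  would be 0, hence the hypothesis.\<close>

lemma second_rhs_eq_dsum:
  assumes "n > 0"
  shows "Sum_any (\<lambda>j::nat. q ^ (j * (3 * j - 1)) * qpoch q (q ^ 3) j * qbinom q (int n) (3 * int j))
    = dsum 0 n - q * dsum 1 (n - 1)"
proof -
  let ?b = "\<lambda>j::nat. q ^ (j * (3 * j - 1)) * qpoch q (q ^ 3) j"
  have b0: "?b 0 = 1"
    by (simp add: qpoch_def)
  have "Sum_any (\<lambda>j. ?b j * qbinom q (int n) (3 * int j)) =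
      (if n = 0 then 1 else dsum 0 n - q * dsum 1 (n - 1))"
  proof (rule rec_sol_unique[OF rec_sol_second_rhs rec_sol_dsum_diff])
    show "Sum_any (\<lambda>j. ?b j * qbinom q (int 0) (3 * int j)) =
        (if (0::nat) = 0 then 1 else dsum 0 0 - q * dsum 1 (0 - 1))"
      using Sum_any_eq_qbinom_sum[of 0 ?b 0] qbinom_0[of 0] b0 by simp
    show "Sum_any (\<lambda>j. ?b j * qbinom q (int 1) (3 * int j)) =
        (if (1::nat) = 0 then 1 else dsum 0 1 - q * dsum 1 (1 - 1))"
      using Sum_any_eq_qbinom_sum[of 0 ?b 1] qbinom_0[of 1] b0
      by (simp add: dsum_0 dsum_1[simplified])
  qed
  then show ?thesis
    using assms by simp
qed

end

theorem theorem1p4: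
  fixes q :: "'a::field" and n :: nat
  assumes "\<And>k::nat. k \<ge> 1 \<Longrightarrow> q ^ k \<noteq> 1"
    and "n \<ge> 1"
  shows
    "Sum_any (\<lambda>(i::nat, j::nat).
        (-1) ^ j * q ^ (i ^ 2 + 3 * i * j + (3 * j * (3 * j + 1)) div 2)
          * qbinom q (int n - int i - 3 * int j) (int i)
          * qbinom (q ^ 3) (int n - int i - 2 * int j - 1) (int j))
     = Sum_any (\<lambda>j::nat.
        q ^ (j * (3 * j + 1)) * qpoch (q ^ 2) (q ^ 3) j * qbinom q (int n) (3 * int j + 1))
   \<and> Sum_any (\<lambda>(i::nat, j::nat).
        (-1) ^ j * q ^ (i ^ 2 + 3 * i * j + (3 * j * (3 * j + 1)) div 2)
          * qbinom q (int n - int i - 3 * int j) (int i)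
          * qbinom (q ^ 3) (int n - int i - 2 * int j - 1) (int j))
     - q * Sum_any (\<lambda>(i::nat, j::nat).
        (-1) ^ j * q ^ (i * (i + 1) + 3 * i * j + (9 * j * (j + 1)) div 2)
          * qbinom q (int n - int i - 3 * int j - 1) (int i)
          * qbinom (q ^ 3) (int n - int i - 2 * int j - 2) (int j))
     = Sum_any (\<lambda>j::nat.
        q ^ (j * (3 * j - 1)) * qpoch q (q ^ 3) j * qbinom q (int n) (3 * int j))"
proof -
  interpret not_root_of_unity q
    by unfold_locales (fact assms(1))
  have first: "Sum_any (\<lambda>(i::nat, j::nat).
        (-1) ^ j * q ^ (i ^ 2 + 3 * i * j + (3 * j * (3 * j + 1)) div 2)
          * qbinom q (int n - int i - 3 * int j) (int i)
          * qbinom (q ^ 3) (int n - int i - 2 * int j - 1) (int j)) = dsum 0 n"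
    by (rule double_sum_eq_dsum) simp
  \<comment> \<open>The second exponent exceeds the first by \<open>i + 3 * j\<close>, which is the
    case \<open>r = 1\<close>.\<close>
  have exponent: "i * (i + 1) + 3 * i * j + (9 * j * (j + 1)) div 2 =
      i ^ 2 + 3 * i * j + (3 * j * (3 * j + 1)) div 2 + 1 * (i + 3 * j)" for i j :: nat
  proof -
    have "9 * j * (j + 1) = 3 * j * (3 * j + 1) + 2 * (3 * j)"
      by (simp add: algebra_simps)
    then have "(9 * j * (j + 1)) div 2 = (3 * j * (3 * j + 1)) div 2 + 3 * j"
      by simp
    then show ?thesis
      by (simp add: power2_eq_square)
  qed
  \<comment> \<open>The second sum has \<open>n - 1\<close> for \<open>n\<close>;
    \<open>n >= 1\<close> makes natural and integer subtraction agree.\<close>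
  have arg: "int n - int i - 3 * int j - 1 = int (n - 1) - int i - 3 * int j"
    "int n - int i - 2 * int j - 2 = int (n - 1) - int i - 2 * int j - 1" for i j :: nat
    using assms(2) by auto
  have second: "Sum_any (\<lambda>(i::nat, j::nat).
        (-1) ^ j * q ^ (i * (i + 1) + 3 * i * j + (9 * j * (j + 1)) div 2)
          * qbinom q (int n - int i - 3 * int j - 1) (int i)
          * qbinom (q ^ 3) (int n - int i - 2 * int j - 2) (int j)) = dsum 1 (n - 1)"
    unfolding arg by (rule double_sum_eq_dsum) (rule exponent)
  show ?thesis
    unfolding first second using first_rhs_eq_dsum second_rhs_eq_dsum assms(2) by simp
qed

end
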